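(* Let $n$ be a positive integer with $n>16$ and let $i\in\{1,2\}$. Then $r(T_n'',T_n^i)=r(T_n''',T_n^i)=r(T_n^3,T_n^i)=2n-7$.
   Context: All graphs are finite simple graphs. For graphs $G_1,G_2$, the Ramsey number $r(G_1,G_2)$ is the smallest positive integer $N$ such that for every graph $G$ on $N$ vertices, either $G$ contains a (not necessarily induced) subgraph isomorphic to $G_1$, or the complement $\overline{G}$ contains a subgraph isomorphic to $G_2$. On vertex set $\{v_0,\ldots,v_{n-1}\}$: $T_n^1$ has edges $v_0v_1,\ldots,v_0v_{n-3},v_{n-4}v_{n-2},v_{n-3}v_{n-1}$; $T_n^2$ has edges $v_0v_1,\ldots,v_0v_{n-3},v_{n-3}v_{n-2},v_{n-3}v_{n-1}$; $T_n''$ has edges $v_0v_1,\ldots,v_0v_{n-4},v_1v_{n-3},v_1v_{n-2},v_2v_{n-1}$; $T_n'''$ has edges $v_0v_1,\ldots,v_0v_{n-4},v_1v_{n-3},v_2v_{n-2},v_3v_{n-1}$; $T_n^3$ has edges $v_0v_1,\ldots,v_0v_{n-4},v_{n-4}v_{n-3},v_{n-4}v_{n-2},v_{n-4}v_{n-1}$. *)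

theory Defs
  imports "HOL-Library.Ramsey"
begin

text \<open>
  A graph is a pair of a vertex set and an edge set; \<^term>\<open>[V]\<^bsup>2\<^esup>\<close> is the set of
  two-element subsets of \<^term>\<open>V\<close>, so edges are undirected, loopless and simple.
\<close>

type_synonym 'a graph = "'a set \<times> 'a set set"

abbreviation verts :: "'a graph \<Rightarrow> 'a set" where
  "verts G \<equiv> fst G"

abbreviation edges :: "'a graph \<Rightarrow> 'a set set" where
  "edges G \<equiv> snd G"

definition fin_graph :: "'a graph \<Rightarrow> bool" where
  "fin_graph G \<longleftrightarrow> finite (verts G) \<and> edges G \<subseteq> [verts G]\<^bsup>2\<^esup>"

definition complement_graph :: "'a graph \<Rightarrow> 'a graph" where
  "complement_graph G = (verts G, [verts G]\<^bsup>2\<^esup> - edges G)"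

definition subgraph :: "'a graph \<Rightarrow> 'a graph \<Rightarrow> bool" where
  "subgraph H G \<longleftrightarrow> fin_graph H \<and> verts H \<subseteq> verts G \<and> edges H \<subseteq> edges G"

definition isomorphic_graphs :: "'a graph \<Rightarrow> 'b graph \<Rightarrow> bool" where
  "isomorphic_graphs G H \<longleftrightarrow>
     (\<exists>f. bij_betw f (verts G) (verts H) \<and> (`) f ` edges G = edges H)"

definition contains_copy :: "'a graph \<Rightarrow> 'b graph \<Rightarrow> bool" where
  "contains_copy G H \<longleftrightarrow> (\<exists>K. subgraph K G \<and> isomorphic_graphs K H)"

text \<open>
  Every finite graph is isomorphic to one whose vertices are natural numbers, so it is no
  restriction to let the host graph range over graphs with vertices in \<^typ>\<open>nat\<close>.
\<close>

definition ramsey_number :: "'a graph \<Rightarrow> 'b graph \<Rightarrow> nat" where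
  "ramsey_number G1 G2 =
     (LEAST N. 0 < N \<and>
        (\<forall>G :: nat graph. fin_graph G \<and> card (verts G) = N \<longrightarrow>
           contains_copy G G1 \<or> contains_copy (complement_graph G) G2))"

text \<open>
  The vertex \<open>v\<^sub>k\<close> is the natural number \<open>k\<close>. The definitions of the five trees are
  meaningful only when \<open>n\<close> is large enough that no subtraction truncates and the listed
  vertices are distinct (\<open>n \<ge> 7\<close> suffices).
\<close>

definition T1 :: "nat \<Rightarrow> nat graph" where
  "T1 n = ({0..<n}, {{0, k} | k. 1 \<le> k \<and> k \<le> n - 3} \<union> {{n - 4, n - 2}, {n - 3, n - 1}})"

definition T2 :: "nat \<Rightarrow> nat graph" where
  "T2 n = ({0..<n}, {{0, k} | k. 1 \<le> k \<and> k \<le> n - 3} \<union> {{n - 3, n - 2}, {n - 3, n - 1}})"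

definition T3 :: "nat \<Rightarrow> nat graph" where
  "T3 n = ({0..<n}, {{0, k} | k. 1 \<le> k \<and> k \<le> n - 4} \<union>
                    {{n - 4, n - 3}, {n - 4, n - 2}, {n - 4, n - 1}})"

definition T_dprime :: "nat \<Rightarrow> nat graph" where
  "T_dprime n = ({0..<n}, {{0, k} | k. 1 \<le> k \<and> k \<le> n - 4} \<union>
                          {{1, n - 3}, {1, n - 2}, {2, n - 1}})"

definition T_tprime :: "nat \<Rightarrow> nat graph" where
  "T_tprime n = ({0..<n}, {{0, k} | k. 1 \<le> k \<and> k \<le> n - 4} \<union>
                          {{1, n - 3}, {2, n - 2}, {3, n - 1}})"

end

theory Submission
  imports Defs
begin

text \<open>
  Put \<open>k = n - 4\<close>. Two disjoint cliques on \<open>k\<close> vertices show that \<open>2 k\<close> vertices are not enough: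
  every degree is below \<open>k\<close>, and every degree in the complement is at most \<open>k\<close>, whereas the centre
  of \<open>T\<^sub>n\<^sup>1\<close> and \<open>T\<^sub>n\<^sup>2\<close> has degree \<open>k + 1\<close>.

  Now let \<open>G\<close> have \<open>2 k + 1\<close> vertices, so that the degrees of a vertex in \<open>G\<close> and in its complement
  add up to \<open>2 k\<close>. If some vertex \<open>v\<close> has degree at least \<open>k + 1\<close> in the complement and the complement
  contains no \<open>T\<^sub>n\<^sup>i\<close>, then the complement is sparse next to \<open>v\<close>: either many neighbours of \<open>v\<close> have
  complement degree at most 3, or almost all edges of \<open>G\<close> between the neighbours and the
  non-neighbours of \<open>v\<close> are present. Both make \<open>G\<close> dense enough to embed the three trees greedily.

  Otherwise \<open>G\<close> has minimum degree at least \<open>k\<close>. A vertex of degree at least \<open>k + 3\<close> allows a greedy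
  embedding. If there is none, double counting the edges between a neighbourhood and its complement
  gives an edge \<open>v x\<close> such that \<open>x\<close> has three neighbours outside the closed neighbourhood of \<open>v\<close>,
  which yields \<open>T\<^sub>n\<^sup>3\<close>. The trees \<open>T\<^sub>n''\<close> and \<open>T\<^sub>n'''\<close> are found around a vertex of degree \<open>k + 1\<close>
  or \<open>k + 2\<close> if there is one, and around \<open>v\<close> if \<open>G\<close> is \<open>k\<close>-regular.
\<close>

subsection \<open>Neighbourhoods and copies\<close>

definition nbhd :: "'a graph \<Rightarrow> 'a \<Rightarrow> 'a set" where
  "nbhd G v = {w. {v, w} \<in> edges G}"

lemma nbhd_sym: "w \<in> nbhd G v \<longleftrightarrow> v \<in> nbhd G w"
  by (simp add: nbhd_def insert_commute)

lemma nbhd_subset: "fin_graph G \<Longrightarrow> nbhd G v \<subseteq> verts G - {v}"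
  by (force simp: nbhd_def fin_graph_def nsets_def card_insert_if)

lemma finite_nbhd: "fin_graph G \<Longrightarrow> finite (nbhd G v)"
  by (meson fin_graph_def finite_Diff finite_subset nbhd_subset)

lemma nbhd_complement:
  assumes "fin_graph G" "v \<in> verts G"
  shows "nbhd (complement_graph G) v = verts G - {v} - nbhd G v"
  using assms by (auto simp: nbhd_def complement_graph_def nsets_def card_insert_if)

lemma fin_graph_complement: "fin_graph G \<Longrightarrow> fin_graph (complement_graph G)"
  by (auto simp: fin_graph_def complement_graph_def)

lemma nbhd_verts: "fin_graph G \<Longrightarrow> w \<in> nbhd G v \<Longrightarrow> v \<in> verts G \<and> w \<in> verts G"
  by (auto simp: nbhd_def fin_graph_def nsets_def)

lemma card_nbhd_complement:
  assumes "fin_graph G" "v \<in> verts G"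
  shows "card (nbhd G v) + card (nbhd (complement_graph G) v) = card (verts G) - 1"
proof -
  have "card (verts G - {v} - nbhd G v) = card (verts G - {v}) - card (nbhd G v)"
    using finite_nbhd[OF assms(1)] nbhd_subset[OF assms(1)] by (rule card_Diff_subset)
  moreover have "card (nbhd G v) \<le> card (verts G - {v})"
    using assms by (intro card_mono nbhd_subset) (auto simp: fin_graph_def)
  ultimately show ?thesis
    using assms by (simp add: nbhd_complement fin_graph_def)
qed

text \<open>The list \<open>vs\<close> is the embedding itself: vertex \<open>i\<close> of
  \<open>H\<close> goes to \<open>vs ! i\<close>. The copy is the image of \<open>H\<close>, and
  since an isomorphism from the copy onto \<open>H\<close> is asked for, it is the inverse of this
  indexing.\<close>

lemma contains_copyI:
  fixes H :: "nat graph"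
  assumes "distinct vs" "verts H = {0..<length vs}" "edges H \<subseteq> [verts H]\<^bsup>2\<^esup>"
    and "fin_graph G"
    and adj: "\<And>i j. {i, j} \<in> edges H \<Longrightarrow> vs ! j \<in> nbhd G (vs ! i)"
    and vs: "set vs \<subseteq> verts G"
  shows "contains_copy G H"
proof -
  define K where "K = (set vs, (`) ((!) vs) ` edges H)"
  let ?f = "inv_into {0..<length vs} ((!) vs)"
  have bij: "bij_betw ((!) vs) {0..<length vs} (set vs)"
    using assms(1) by (auto intro: bij_betw_nth)
  have pair: "\<exists>i j. e = {i, j} \<and> i \<noteq> j \<and> i < length vs \<and> j < length vs" if "e \<in> edges H" for e
    using subsetD[OF assms(3) that] by (rule nsets2_E) (use assms(2) in auto)
  have K: "\<exists>i j. e = {vs ! i, vs ! j} \<and> {i, j} \<in> edges H \<and> i \<noteq> j \<and> i < length vs \<and> j < length vs"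
    if e: "e \<in> edges K" for e
  proof -
    obtain d where d: "d \<in> edges H" "e = (!) vs ` d"
      using e unfolding K_def snd_conv by blast
    then show ?thesis
      using pair[OF d(1)] by auto
  qed
  have "edges K \<subseteq> edges G"
    using K adj by (force simp: nbhd_def)
  moreover have "edges K \<subseteq> [verts K]\<^bsup>2\<^esup>"
  proof
    fix e assume "e \<in> edges K"
    from K[OF this] show "e \<in> [verts K]\<^bsup>2\<^esup>"
      using assms(1) by (auto simp: K_def nth_eq_iff_index_eq)
  qed
  ultimately have "subgraph K G"
    using vs by (auto simp: subgraph_def fin_graph_def K_def)
  moreover have "isomorphic_graphs K H"
    unfolding isomorphic_graphs_def
  proof (intro exI conjI)
    show "bij_betw ?f (verts K) (verts H)"
      using bij_betw_inv_into[OF bij] assms(2) by (simp add: K_def)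
    have "?f ` ((!) vs) ` e = e" if "e \<in> edges H" for e
      using that assms(2,3) bij by (intro inv_into_image_cancel) (auto simp: nsets_def bij_betw_def)
    then show "(`) ?f ` edges K = edges H"
      by (simp add: K_def image_image)
  qed
  ultimately show ?thesis
    unfolding contains_copy_def by blast
qed

text \<open>The obstruction behind the lower bound: neighbours of \<open>c\<close> pull back to
  neighbours of its preimage, so a host graph with only small degrees contains no large
  star.\<close>

lemma contains_copy_degree:
  assumes "contains_copy G H" "fin_graph G" "c \<in> verts H" "S \<subseteq> nbhd H c \<inter> verts H"
  shows "\<exists>v. card S \<le> card (nbhd G v)"
proof -
  obtain K f where K: "subgraph K G" and bij: "bij_betw f (verts K) (verts H)"
    and im: "(`) f ` edges K = edges H"
    using assms(1) unfolding contains_copy_def isomorphic_graphs_def by blast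
  obtain v where v: "v \<in> verts K" "f v = c"
    using assms(3) bij by (metis bij_betw_imp_surj_on imageE)
  have "S \<subseteq> f ` nbhd G v"
  proof
    fix w assume "w \<in> S"
    then have w: "w \<in> nbhd H c" "w \<in> verts H"
      using assms(4) by auto
    then obtain e where e: "e \<in> edges K" "{c, w} = f ` e"
      using w im unfolding nbhd_def mem_Collect_eq by blast
    obtain u where u: "u \<in> verts K" "f u = w"
      using w bij by (metis bij_betw_imp_surj_on imageE)
    have "e \<subseteq> verts K"
      using e K by (auto simp: subgraph_def fin_graph_def nsets_def)
    then have "e = {v, u}"
      using e u v bij inj_on_image_eq_iff[of f "verts K" "{v, u}" e] by (auto simp: bij_betw_def)
    then show "w \<in> f ` nbhd G v"
      using e u K by (auto simp: nbhd_def subgraph_def)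
  qed
  then show ?thesis
    using finite_nbhd[OF assms(2)] by (meson surj_card_le)
qed

lemma obtain_list:
  assumes "finite S" "m \<le> card S"
  obtains xs where "distinct xs" "set xs \<subseteq> S" "length xs = m"
proof -
  obtain X where "X \<subseteq> S" "card X = m" "finite X"
    using assms by (meson finite_subset obtain_subset_with_card_n)
  then show thesis
    using finite_distinct_list[of X] that by (metis distinct_card)
qed

subsection \<open>Embedding the trees around a given centre\<close>

text \<open>All five trees are a star at \<open>0\<close> with \<open>d\<close> leaves plus two or
  three further edges. In \<open>vs\<close> the centre comes first, then the leaves
  \<open>L\<close>, then the vertices \<open>W\<close> off the star, so only the further edges
  listed in \<open>E\<close> remain to be checked by index.\<close>

lemma copy_starI:
  assumes "H = ({0..<m}, {{0, i} | i. 1 \<le> i \<and> i \<le> d} \<union> (\<lambda>(i, j). {i, j}) ` set E)"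
    and "vs = c # L @ W"
    and G: "fin_graph G" and c: "c \<in> verts G"
    and vs: "distinct vs" "length vs = m" "length L = d"
    and L: "set L \<subseteq> nbhd G c" and W: "set W \<subseteq> verts G"
    and E: "list_all (\<lambda>(i, j). i < m \<and> j < m \<and> vs ! j \<in> nbhd G (vs ! i)) E"
  shows "contains_copy G H"
proof (rule contains_copyI[of vs])
  have star: "vs ! i \<in> nbhd G c" if "1 \<le> i" "i \<le> d" for i
    using that L vs(3) by (auto simp: \<open>vs = _\<close> nth_append nth_Cons' subset_iff)
  have adj: "\<exists>i j. e = {i, j} \<and> i < m \<and> j < m \<and> vs ! j \<in> nbhd G (vs ! i)"
    if e: "e \<in> edges H" for e
  proof (cases "e \<in> (\<lambda>(i, j). {i, j}) ` set E")
    case False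
    then obtain i where "e = {0, i}" "1 \<le> i" "i \<le> d"
      using e assms(1) by auto
    then show ?thesis
      using star[of i] vs by (intro exI[of _ 0] exI[of _ i]) (auto simp: \<open>vs = _\<close>)
  next
    case True
    then show ?thesis
      using E by (fastforce simp: list_all_iff)
  qed
  show "vs ! j \<in> nbhd G (vs ! i)" if "{i, j} \<in> edges H" for i j
  proof -
    from adj[OF that] have "vs ! j \<in> nbhd G (vs ! i) \<or> vs ! i \<in> nbhd G (vs ! j)"
      by (auto simp: doubleton_eq_iff)
    then show ?thesis
      using nbhd_sym[of "vs ! i" G "vs ! j"] by blast
  qed
  show "edges H \<subseteq> [verts H]\<^bsup>2\<^esup>"
  proof
    fix e assume "e \<in> edges H"
    with adj obtain i j where "e = {i, j}" "i < m" "j < m" "vs ! j \<in> nbhd G (vs ! i)"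
      by blast
    moreover from this have "i \<noteq> j"
      using nbhd_subset[OF G] by blast
    ultimately show "e \<in> [verts H]\<^bsup>2\<^esup>"
      by (simp add: assms(1))
  qed
  show "set vs \<subseteq> verts G"
    using c L W nbhd_subset[OF G] by (fastforce simp: \<open>vs = _\<close>)
  show "distinct vs" "verts H = {0..<length vs}" "fin_graph G"
    using vs G assms(1) by simp_all
qed

text \<open>The leaves in \<open>X\<close> are prescribed because further edges hang from them;
  \<open>W\<close> is reserved for the other ends of those edges. The star is completed from the
  rest of the neighbourhood.\<close>

lemma obtain_leaves:
  assumes G: "fin_graph G" and "set X \<subseteq> nbhd G c - W" "distinct X" "d \<le> card (nbhd G c - W)"
  obtains L where "distinct (c # L)" "set L \<subseteq> nbhd G c - W - set X" "length L = d - length X"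
proof -
  have "card (nbhd G c - W - set X) = card (nbhd G c - W) - length X"
    using assms by (simp add: card_Diff_subset distinct_card)
  then have "d - length X \<le> card (nbhd G c - W - set X)" "finite (nbhd G c - W - set X)"
    using assms(4) finite_nbhd[OF G] by auto
  then obtain L where L: "distinct L" "set L \<subseteq> nbhd G c - W - set X" "length L = d - length X"
    using obtain_list by blast
  moreover have "c \<notin> set L"
    using L nbhd_subset[OF G] by blast
  ultimately show thesis
    using that[of L] by simp
qed

text \<open>The pendant vertices may themselves be neighbours of \<open>c\<close>, so
  \<open>k\<close> leaves are required apart from them. Here and in the next four lemmas, the leaves
  that carry further edges stand at the front or the end of the leaf list, according to their
  numbers in the tree.\<close>

lemma copy_T3:
  assumes G: "fin_graph G" and x: "x \<in> nbhd G c"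
    and w: "{w1, w2, w3} \<subseteq> nbhd G x" "distinct [c, w1, w2, w3]"
    and k: "0 < k" "k \<le> card (nbhd G c - {w1, w2, w3})"
  shows "contains_copy G (T3 (k + 4))"
proof -
  have x': "c \<noteq> x" "x \<notin> {w1, w2, w3}"
    using x w nbhd_subset[OF G] by blast+
  then obtain L where L: "distinct (c # L)" "set L \<subseteq> nbhd G c - {w1, w2, w3} - set [x]"
    "length L = k - length [x]"
    using obtain_leaves[OF G, of "[x]" c "{w1, w2, w3}" k] x k by auto
  let ?vs = "c # (L @ [x]) @ [w1, w2, w3]"
  have last: "?vs ! k = x" "?vs ! (k + 1) = w1" "?vs ! (k + 2) = w2" "?vs ! (k + 3) = w3"
    using k L by (auto simp: nth_append nth_Cons')
  show ?thesis
  proof (rule copy_starI[where c = c and L = "L @ [x]" and W = "[w1, w2, w3]"])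
    show "T3 (k + 4) = ({0..<k + 4}, {{0, i} | i. 1 \<le> i \<and> i \<le> k} \<union>
      (\<lambda>(i, j). {i, j}) ` set [(k, k + 1), (k, k + 2), (k, k + 3)])"
      by (simp add: T3_def add.commute[of 3 k])
    show "list_all (\<lambda>(i, j). i < k + 4 \<and> j < k + 4 \<and> ?vs ! j \<in> nbhd G (?vs ! i))
      [(k, k + 1), (k, k + 2), (k, k + 3)]"
      using w k by (simp only: list.pred_inject prod.case last) simp
  qed (use L x x' w k G nbhd_verts[OF G] in \<open>auto simp del: One_nat_def\<close>)
qed

lemma copy_T_dprime:
  assumes G: "fin_graph G" and x: "{x, y} \<subseteq> nbhd G c"
    and w: "{w1, w2} \<subseteq> nbhd G x" "w3 \<in> nbhd G y" "distinct [c, x, y, w1, w2, w3]"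
    and k: "2 \<le> k" "k \<le> card (nbhd G c - {w1, w2, w3})"
  shows "contains_copy G (T_dprime (k + 4))"
proof -
  obtain L where L: "distinct (c # L)" "set L \<subseteq> nbhd G c - {w1, w2, w3} - set [x, y]"
    "length L = k - length [x, y]"
    using obtain_leaves[OF G, of "[x, y]" c "{w1, w2, w3}" k] x w k by auto
  let ?vs = "c # ([x, y] @ L) @ [w1, w2, w3]"
  have last: "?vs ! 1 = x" "?vs ! 2 = y"
    "?vs ! (k + 1) = w1" "?vs ! (k + 2) = w2" "?vs ! (k + 3) = w3"
    using k L by (auto simp: nth_append nth_Cons')
  show ?thesis
  proof (rule copy_starI[where c = c and L = "[x, y] @ L" and W = "[w1, w2, w3]"])
    show "T_dprime (k + 4) = ({0..<k + 4}, {{0, i} | i. 1 \<le> i \<and> i \<le> k} \<union>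
      (\<lambda>(i, j). {i, j}) ` set [(1, k + 1), (1, k + 2), (2, k + 3)])"
      by (simp add: T_dprime_def add.commute[of 3 k])
    show "list_all (\<lambda>(i, j). i < k + 4 \<and> j < k + 4 \<and> ?vs ! j \<in> nbhd G (?vs ! i))
      [(1, k + 1), (1, k + 2), (2, k + 3)]"
      using w k by (simp only: list.pred_inject prod.case last) simp
  qed (use L x w k G nbhd_verts[OF G] in \<open>auto simp del: One_nat_def\<close>)
qed

lemma copy_T_tprime:
  assumes G: "fin_graph G" and x: "{x, y, z} \<subseteq> nbhd G c"
    and w: "w1 \<in> nbhd G x" "w2 \<in> nbhd G y" "w3 \<in> nbhd G z" "distinct [c, x, y, z, w1, w2, w3]"
    and k: "3 \<le> k" "k \<le> card (nbhd G c - {w1, w2, w3})"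
  shows "contains_copy G (T_tprime (k + 4))"
proof -
  obtain L where L: "distinct (c # L)" "set L \<subseteq> nbhd G c - {w1, w2, w3} - set [x, y, z]"
    "length L = k - length [x, y, z]"
    using obtain_leaves[OF G, of "[x, y, z]" c "{w1, w2, w3}" k] x w k by auto
  let ?vs = "c # ([x, y, z] @ L) @ [w1, w2, w3]"
  have last: "?vs ! 1 = x" "?vs ! 2 = y" "?vs ! 3 = z"
    "?vs ! (k + 1) = w1" "?vs ! (k + 2) = w2" "?vs ! (k + 3) = w3"
    using k L by (auto simp: nth_append nth_Cons')
  show ?thesis
  proof (rule copy_starI[where c = c and L = "[x, y, z] @ L" and W = "[w1, w2, w3]"])
    show "T_tprime (k + 4) = ({0..<k + 4}, {{0, i} | i. 1 \<le> i \<and> i \<le> k} \<union>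
      (\<lambda>(i, j). {i, j}) ` set [(1, k + 1), (2, k + 2), (3, k + 3)])"
      by (simp add: T_tprime_def add.commute[of 3 k])
    show "list_all (\<lambda>(i, j). i < k + 4 \<and> j < k + 4 \<and> ?vs ! j \<in> nbhd G (?vs ! i))
      [(1, k + 1), (2, k + 2), (3, k + 3)]"
      using w k by (simp only: list.pred_inject prod.case last) simp
  qed (use L x w k G nbhd_verts[OF G] in \<open>auto simp del: One_nat_def\<close>)
qed

lemma copy_T1:
  assumes G: "fin_graph G" and x: "{x, y} \<subseteq> nbhd G c"
    and w: "w1 \<in> nbhd G x" "w2 \<in> nbhd G y" "distinct [c, x, y, w1, w2]"
    and k: "1 \<le> k" "k + 1 \<le> card (nbhd G c - {w1, w2})"
  shows "contains_copy G (T1 (k + 4))"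
proof -
  obtain L where L: "distinct (c # L)" "set L \<subseteq> nbhd G c - {w1, w2} - set [x, y]"
    "length L = k + 1 - length [x, y]"
    using obtain_leaves[OF G, of "[x, y]" c "{w1, w2}" "k + 1"] x w k by auto
  let ?vs = "c # (L @ [x, y]) @ [w1, w2]"
  have last: "?vs ! k = x" "?vs ! (k + 1) = y" "?vs ! (k + 2) = w1" "?vs ! (k + 3) = w2"
    using k L by (auto simp: nth_append nth_Cons')
  show ?thesis
  proof (rule copy_starI[where c = c and L = "L @ [x, y]" and W = "[w1, w2]"])
    show "T1 (k + 4) = ({0..<k + 4}, {{0, i} | i. 1 \<le> i \<and> i \<le> k + 1} \<union>
      (\<lambda>(i, j). {i, j}) ` set [(k, k + 2), (k + 1, k + 3)])"
      by (simp add: T1_def add.commute[of 3 k])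
    show "list_all (\<lambda>(i, j). i < k + 4 \<and> j < k + 4 \<and> ?vs ! j \<in> nbhd G (?vs ! i))
      [(k, k + 2), (k + 1, k + 3)]"
      using w k by (simp only: list.pred_inject prod.case last) simp
  qed (use L x w k G nbhd_verts[OF G] in \<open>auto simp del: One_nat_def\<close>)
qed

lemma copy_T2:
  assumes G: "fin_graph G" and x: "x \<in> nbhd G c"
    and w: "{w1, w2} \<subseteq> nbhd G x" "distinct [c, w1, w2]"
    and k: "k + 1 \<le> card (nbhd G c - {w1, w2})"
  shows "contains_copy G (T2 (k + 4))"
proof -
  have x': "c \<noteq> x" "x \<notin> {w1, w2}"
    using x w nbhd_subset[OF G] by blast+
  then obtain L where L: "distinct (c # L)" "set L \<subseteq> nbhd G c - {w1, w2} - set [x]"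
    "length L = k + 1 - length [x]"
    using obtain_leaves[OF G, of "[x]" c "{w1, w2}" "k + 1"] x k by auto
  let ?vs = "c # (L @ [x]) @ [w1, w2]"
  have last: "?vs ! (k + 1) = x" "?vs ! (k + 2) = w1" "?vs ! (k + 3) = w2"
    using L by (auto simp: nth_append nth_Cons')
  show ?thesis
  proof (rule copy_starI[where c = c and L = "L @ [x]" and W = "[w1, w2]"])
    show "T2 (k + 4) = ({0..<k + 4}, {{0, i} | i. 1 \<le> i \<and> i \<le> k + 1} \<union>
      (\<lambda>(i, j). {i, j}) ` set [(k + 1, k + 2), (k + 1, k + 3)])"
      by (simp add: T2_def add.commute[of 3 k])
    show "list_all (\<lambda>(i, j). i < k + 4 \<and> j < k + 4 \<and> ?vs ! j \<in> nbhd G (?vs ! i))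
      [(k + 1, k + 2), (k + 1, k + 3)]"
      using w k by (simp only: list.pred_inject prod.case last) simp
  qed (use L x x' w G nbhd_verts[OF G] in \<open>auto simp del: One_nat_def\<close>)
qed

section \<open>Greedy choice and double counting\<close>

lemma ex_notin_list:
  assumes "length xs < card S"
  obtains x where "x \<in> S" "x \<notin> set xs"
proof -
  have "\<not> S \<subseteq> set xs"
    using assms card_mono[of "set xs" S] card_length[of xs] by auto
  then show thesis
    using that by blast
qed

lemma card_Diff_list: "card S - length xs \<le> card (S - set xs)"
  using diff_card_le_card_Diff[of "set xs" S] card_length[of xs] by simp

text \<open>Both sides count the adjacent pairs in the product of \<open>X\<close> and
  \<open>Y\<close>, grouped by either component.\<close>

lemma sum_card_nbhd_swap:
  assumes "finite X" "finite Y"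
  shows "(\<Sum>x\<in>X. card (nbhd G x \<inter> Y)) = (\<Sum>y\<in>Y. card (nbhd G y \<inter> X))"
proof -
  have card: "card (nbhd G x \<inter> Z) = (\<Sum>z\<in>Z. if z \<in> nbhd G x then 1 else 0)" if "finite Z" for x Z
    using that by (simp add: sum.If_cases Int_commute)
  have "(\<Sum>x\<in>X. card (nbhd G x \<inter> Y)) = (\<Sum>x\<in>X. \<Sum>y\<in>Y. if y \<in> nbhd G x then 1 else 0)"
    using assms by (simp add: card)
  also have "\<dots> = (\<Sum>y\<in>Y. \<Sum>x\<in>X. if x \<in> nbhd G y then 1 else 0)"
    by (subst sum.swap) (simp add: nbhd_sym)
  finally show ?thesis
    using assms by (simp add: card)
qed

section \<open>Sufficient conditions for all three trees at once\<close>

abbreviation small_star_trees :: "nat \<Rightarrow> nat graph set" where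
  "small_star_trees k \<equiv> {T_dprime (k + 4), T_tprime (k + 4), T3 (k + 4)}"

text \<open>The pendant vertices are chosen outside \<open>L\<close>, so no leaf is lost. Each
  choice has to avoid at most two earlier ones, hence three candidates per leaf suffice.\<close>

lemma copy_of_leaves:
  assumes G: "fin_graph G" and L: "L \<subseteq> nbhd G c" "k \<le> card L" and "3 \<le> k"
    and X: "{x, y, z} \<subseteq> L" "distinct [x, y, z]"
    and W: "\<And>u. u \<in> {x, y, z} \<Longrightarrow> 3 \<le> card (nbhd G u - L - {c})"
    and T: "T \<in> small_star_trees k"
  shows "contains_copy G T"
proof -
  have fit: "k \<le> card (nbhd G c - {w1, w2, w3})" if "{w1, w2, w3} \<inter> L = {}" for w1 w2 w3
  proof -
    have "card L \<le> card (nbhd G c - {w1, w2, w3})"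
      using that L finite_nbhd[OF G] by (intro card_mono) auto
    then show ?thesis
      using L by simp
  qed
  have c: "c \<notin> L"
    using L nbhd_subset[OF G] by blast
  let ?P = "\<lambda>u. nbhd G u - L - {c}"
  have pick: "\<exists>w. w \<in> ?P u \<and> w \<notin> set ws" if "u \<in> {x, y, z}" "length ws \<le> 2" for u ws
  proof -
    have "length ws < card (?P u)"
      using W[OF that(1)] that(2) by linarith
    then show ?thesis
      using ex_notin_list by blast
  qed
  obtain x1 where x1: "x1 \<in> ?P x"
    using pick[of x "[]"] by auto
  obtain x2 where x2: "x2 \<in> ?P x" "x2 \<noteq> x1"
    using pick[of x "[x1]"] by auto
  obtain x3 where x3: "x3 \<in> ?P x" "x3 \<noteq> x1" "x3 \<noteq> x2"
    using pick[of x "[x1, x2]"] by auto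
  \<comment> \<open>Avoiding \<open>x2\<close> as well lets \<open>y1\<close> serve in both trees:
    next to \<open>x1\<close>, \<open>x2\<close> in \<open>T_dprime\<close> and next to
    \<open>x1\<close>, \<open>z1\<close> in \<open>T_tprime\<close>.\<close>
  obtain y1 where y1: "y1 \<in> ?P y" "y1 \<noteq> x1" "y1 \<noteq> x2"
    using pick[of y "[x1, x2]"] by auto
  obtain z1 where z1: "z1 \<in> ?P z" "z1 \<noteq> x1" "z1 \<noteq> y1"
    using pick[of z "[x1, y1]"] by auto
  have "contains_copy G (T3 (k + 4))"
    by (rule copy_T3[OF G, of x c x1 x2 x3])
      (use x1 x2 x3 X L c fit[of x1 x2 x3] \<open>3 \<le> k\<close> in auto)
  moreover have "contains_copy G (T_dprime (k + 4))"
    by (rule copy_T_dprime[OF G, of x y c x1 x2 y1])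
      (use x1 x2 y1 X L c fit[of x1 x2 y1] \<open>3 \<le> k\<close> in auto)
  moreover have "contains_copy G (T_tprime (k + 4))"
    by (rule copy_T_tprime[OF G, of x y z c x1 y1 z1])
      (use x1 y1 z1 X L c fit[of x1 y1 z1] \<open>3 \<le> k\<close> in auto)
  ultimately show ?thesis
    using T by blast
qed

lemma obtain_three:
  assumes "3 \<le> card S"
  obtains x y z where "{x, y, z} \<subseteq> S" "distinct [x, y, z]"
proof -
  obtain X where "X \<subseteq> S" "card X = 3"
    using assms by (meson obtain_subset_with_card_n)
  then show thesis
    using that unfolding card_3_iff by auto
qed

lemma copy_of_bipartite:
  assumes "fin_graph G" "L \<subseteq> nbhd G c" "k \<le> card L" "3 \<le> k"
    and "\<And>u. u \<in> L \<Longrightarrow> 3 \<le> card (nbhd G u - L - {c})"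
    and "T \<in> small_star_trees k"
  shows "contains_copy G T"
proof -
  obtain x y z where "{x, y, z} \<subseteq> L" "distinct [x, y, z]"
    using obtain_three[of L] assms(3,4) by auto
  then show ?thesis
    using assms by (intro copy_of_leaves[of G L c k x y z T]) auto
qed

text \<open>Any \<open>c\<close> in \<open>S\<close> is adjacent to at least
  \<open>7 - 1 - 3 = 3\<close> other members of \<open>S\<close>. Each of these has degree at least
  \<open>2 * k - 3\<close>, so outside \<open>c\<close> and \<open>k\<close> chosen leaves it keeps
  at least \<open>k - 4\<close> neighbours, and \<open>7 \<le> k\<close> makes this at least
  3.\<close>

lemma copy_of_dense:
  assumes G: "fin_graph G" and V: "card (verts G) = 2 * k + 1" and k: "7 \<le> k"
    and S: "S \<subseteq> verts G" "7 \<le> card S"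
    and B: "\<And>s. s \<in> S \<Longrightarrow> card (nbhd (complement_graph G) s) \<le> 3"
    and T: "T \<in> small_star_trees k"
  shows "contains_copy G T"
proof -
  have deg: "2 * k - 3 \<le> card (nbhd G s)" if "s \<in> S" for s
    using card_nbhd_complement[OF G, of s] B[OF that] S that V by auto
  obtain c where c: "c \<in> S"
    using S by fastforce
  let ?B = "nbhd (complement_graph G) c"
  have "card S - 1 - card ?B \<le> card (S - {c} - ?B)"
    using diff_card_le_card_Diff[OF finite_nbhd[OF fin_graph_complement[OF G]], of "S - {c}" c]
      card_Diff_list[of S "[c]"] by simp
  then have "3 \<le> card (S - {c} - ?B)"
    using S B[OF c] by simp
  then obtain x y z where X: "{x, y, z} \<subseteq> S - {c} - ?B" "distinct [x, y, z]"
    by (rule obtain_three)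
  then have "{x, y, z} \<subseteq> nbhd G c"
    using nbhd_complement[OF G, of c] S c by auto
  moreover have "card {x, y, z} \<le> k" "k \<le> card (nbhd G c)"
    using k deg[OF c] X by auto
  ultimately obtain L where L: "{x, y, z} \<subseteq> L" "L \<subseteq> nbhd G c" "card L = k"
    using exists_subset_between[of "{x, y, z}" k "nbhd G c"] finite_nbhd[OF G] by auto
  show ?thesis
  proof (rule copy_of_leaves[OF G L(2) _ _ L(1) X(2) _ T])
    fix u assume "u \<in> {x, y, z}"
    then have "2 * k - 3 \<le> card (nbhd G u)"
      using deg X by auto
    moreover have "card (nbhd G u) - card L \<le> card (nbhd G u - L)"
      using L finite_nbhd[OF G] by (intro diff_card_le_card_Diff) (auto intro: finite_subset)
    moreover have "card (nbhd G u - L) - 1 \<le> card (nbhd G u - L - {c})"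
      using card_Diff_list[of "nbhd G u - L" "[c]"] by simp
    ultimately show "3 \<le> card (nbhd G u - L - {c})"
      using L k by simp
  qed (use L k in auto)
qed

lemma card_nbhd_eq:
  assumes "fin_graph G" "v \<in> verts G" "card (verts G) = 2 * k + 1"
  shows "card (nbhd G v) + card (nbhd (complement_graph G) v) = 2 * k"
  using card_nbhd_complement[OF assms(1,2)] assms(3) by simp

subsection \<open>A vertex of large degree in the complement\<close>

text \<open>A \<open>T2\<close> around \<open>v\<close> in the complement needs a leaf
  \<open>x\<close> with two more complement neighbours and \<open>k + 1\<close> leaves besides these
  two. If \<open>N\<close> has \<open>k + 3\<close> vertices, any two neighbours other than
  \<open>v\<close> will do. If it has fewer, two neighbours in \<open>R\<close> still do, because
  they cost no leaf.\<close>

lemma copy_if_no_T2_in_complement: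
  assumes G: "fin_graph G" and V: "card (verts G) = 2 * k + 1" and k: "7 \<le> k"
    and v: "v \<in> verts G" "k + 1 \<le> card (nbhd (complement_graph G) v)"
    and no: "\<not> contains_copy (complement_graph G) (T2 (k + 4))"
    and T: "T \<in> small_star_trees k"
  shows "contains_copy G T"
proof -
  define B where "B = complement_graph G"
  define N where "N = nbhd B v"
  define R where "R = nbhd G v"
  have B: "fin_graph B"
    using G by (simp add: B_def fin_graph_complement)
  note fin = finite_nbhd[OF G] finite_nbhd[OF B]
  have cards: "card R + card N = 2 * k"
    using card_nbhd_eq[OF G v(1) V] by (simp add: R_def N_def B_def)
  have nB: "nbhd B u = verts G - {u} - nbhd G u" if "u \<in> verts G" for u
    using nbhd_complement[OF G that] by (simp add: B_def)
  have NV: "N \<subseteq> verts G - {v}" and RV: "R \<subseteq> verts G - {v}" and disj: "N \<inter> R = {}"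
    using nB[OF v(1)] nbhd_subset[OF G] by (auto simp: N_def R_def)
  have no': False if "x \<in> N" "{w1, w2} \<subseteq> nbhd B x" "distinct [v, w1, w2]"
    "k + 1 \<le> card (N - {w1, w2})" for x w1 w2
    using copy_T2[OF B, of x v w1 w2 k] that no by (auto simp: N_def B_def)
  show ?thesis
  proof (cases "k + 3 \<le> card N")
    case True
    have "card (nbhd B x) \<le> 3" if x: "x \<in> N" for x
    proof (rule ccontr)
      assume "\<not> card (nbhd B x) \<le> 3"
      then obtain w1 w2 where "w1 \<in> nbhd B x" "w1 \<notin> set [v]" "w2 \<in> nbhd B x" "w2 \<notin> set [v, w1]"
        using ex_notin_list[of "[v]" "nbhd B x"] ex_notin_list[of "[v, _]" "nbhd B x"]
        by (metis One_nat_def Suc_1 length_Cons less_Suc_eq list.size(3) not_le numeral_3_eq_3 less_trans)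
      moreover have "k + 1 \<le> card (N - {w1, w2})"
        using True card_Diff_list[of N "[w1, w2]"] by simp
      ultimately show False
        using no'[of x w1 w2] x by auto
    qed
    then show ?thesis
      using True NV k by (intro copy_of_dense[OF G V k, of N] T) (auto simp: B_def)
  next
    case False
    have few: "card (nbhd B x \<inter> R) \<le> 1" if x: "x \<in> N" for x
    proof (rule ccontr)
      assume "\<not> card (nbhd B x \<inter> R) \<le> 1"
      then obtain w1 w2 where w: "w1 \<in> nbhd B x \<inter> R" "w2 \<in> nbhd B x \<inter> R" "w2 \<notin> set [w1]"
        using ex_notin_list[of "[]" "nbhd B x \<inter> R"] ex_notin_list[of "[_]" "nbhd B x \<inter> R"]
        by (metis One_nat_def length_Cons list.size(3) not_le less_trans zero_less_one)
      then have "N - {w1, w2} = N" "v \<noteq> w1" "v \<noteq> w2"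
        using disj RV by auto
      then show False
        using no'[of x w1 w2] w x v by (auto simp: N_def B_def)
    qed
    \<comment> \<open>There are at most \<open>card N \<le> k + 2\<close> complement edges between
      \<open>N\<close> and \<open>R\<close>, fewer than \<open>2 * card R\<close>, which is at least
      \<open>2 * (k - 2)\<close>.\<close>
    have "\<exists>r\<in>R. card (nbhd B r \<inter> N) \<le> 1"
    proof (rule ccontr)
      assume "\<not> ?thesis"
      then have "card R * 2 \<le> (\<Sum>r\<in>R. card (nbhd B r \<inter> N))"
        using sum_bounded_below[of R 2 "\<lambda>r. card (nbhd B r \<inter> N)"] by force
      also have "\<dots> = (\<Sum>x\<in>N. card (nbhd B x \<inter> R))"
        using fin by (intro sum_card_nbhd_swap) (auto simp: N_def R_def)
      also have "\<dots> \<le> card N"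
        using few sum_bounded_above[of N "\<lambda>x. card (nbhd B x \<inter> R)" 1] by force
      finally show False
        using cards False k by simp
    qed
    then obtain r where r: "r \<in> R" "card (nbhd B r \<inter> N) \<le> 1" ..
    have "N - nbhd B r \<inter> N \<subseteq> N \<inter> nbhd G r"
      using nB[of r] r NV RV disj by auto
    then have "card (N - nbhd B r \<inter> N) \<le> card (N \<inter> nbhd G r)"
      using fin by (intro card_mono) (auto simp: N_def)
    then have L: "k \<le> card (N \<inter> nbhd G r)"
      using diff_card_le_card_Diff[of "nbhd B r \<inter> N" N] fin(2)[of r] r v by (auto simp: N_def B_def)
    \<comment> \<open>The new centre is \<open>r\<close>, adjacent in \<open>G\<close> to all but at
      most one vertex of \<open>N\<close>. Each leaf misses at most one vertex of \<open>R\<close>,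
      so at least \<open>k - 4\<close> of them other than \<open>r\<close> can be pendant.\<close>
    show ?thesis
    proof (rule copy_of_bipartite[OF G _ L _ _ T, of r])
      fix u assume u: "u \<in> N \<inter> nbhd G r"
      have "R - nbhd B u \<inter> R - {r} \<subseteq> nbhd G u - N \<inter> nbhd G r - {r}"
        using nB[of u] u NV RV disj by auto
      then have "card (R - nbhd B u \<inter> R - {r}) \<le> card (nbhd G u - N \<inter> nbhd G r - {r})"
        using fin by (intro card_mono) auto
      moreover have "card R - card (nbhd B u \<inter> R) \<le> card (R - nbhd B u \<inter> R)"
        using fin by (intro diff_card_le_card_Diff) auto
      ultimately show "3 \<le> card (nbhd G u - N \<inter> nbhd G r - {r})"
        using card_Diff_list[of "R - nbhd B u \<inter> R" "[r]"] few[of u] u cards False k by simp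
    qed (use k in auto)
  qed
qed

text \<open>A \<open>T1\<close> around \<open>v\<close> in the complement needs two disjoint edges
  starting at distinct leaves. Fixing one such edge from \<open>x\<close> to \<open>w\<close>
  therefore confines every other leaf: its complement neighbours lie in \<open>{v, x, w}\<close>
  when \<open>N\<close> has \<open>k + 3\<close> vertices, and otherwise those in \<open>R\<close>
  reduce to \<open>w\<close>.\<close>

lemma copy_if_no_T1_in_complement:
  assumes G: "fin_graph G" and V: "card (verts G) = 2 * k + 1" and k: "7 \<le> k"
    and v: "v \<in> verts G" "k + 1 \<le> card (nbhd (complement_graph G) v)"
    and no: "\<not> contains_copy (complement_graph G) (T1 (k + 4))"
    and T: "T \<in> small_star_trees k"
  shows "contains_copy G T"
proof -
  define B where "B = complement_graph G"
  define N where "N = nbhd B v"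
  define R where "R = nbhd G v"
  have B: "fin_graph B"
    using G by (simp add: B_def fin_graph_complement)
  note fin = finite_nbhd[OF G] finite_nbhd[OF B]
  have cards: "card R + card N = 2 * k"
    using card_nbhd_eq[OF G v(1) V] by (simp add: R_def N_def B_def)
  have nB: "nbhd B u = verts G - {u} - nbhd G u" if "u \<in> verts G" for u
    using nbhd_complement[OF G that] by (simp add: B_def)
  have NV: "N \<subseteq> verts G - {v}" and RV: "R \<subseteq> verts G - {v}" and disj: "N \<inter> R = {}"
    using nB[OF v(1)] nbhd_subset[OF G] by (auto simp: N_def R_def)
  have no': False if "{x, y} \<subseteq> N" "w \<in> nbhd B x" "z \<in> nbhd B y" "distinct [v, x, y, w, z]"
    "k + 1 \<le> card (N - {w, z})" for x y w z
    using copy_T1[OF B, of x y v w z k] that no k by (auto simp: N_def B_def)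
  have irrefl: "u \<notin> nbhd B u" for u
    using nbhd_subset[OF B] by blast
  show ?thesis
  proof (cases "k + 3 \<le> card N")
    case True
    obtain S where S: "S \<subseteq> N" "k + 1 \<le> card S" "\<And>s. s \<in> S \<Longrightarrow> card (nbhd B s) \<le> 3"
    proof (cases "\<exists>x\<in>N. \<exists>w\<in>nbhd B x. w \<noteq> v")
      case True
      then obtain x w where x: "x \<in> N" "w \<in> nbhd B x" "w \<noteq> v"
        by blast
      have "nbhd B y \<subseteq> set [v, x, w]" if y: "y \<in> N - {x, w}" for y
      proof
        fix z assume "z \<in> nbhd B y"
        moreover have "k + 1 \<le> card (N - {w, z})"
          using \<open>k + 3 \<le> card N\<close> card_Diff_list[of N "[w, z]"] by simp
        ultimately show "z \<in> set [v, x, w]"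
          using no'[of x y w z] x y NV irrefl by auto
      qed
      then have "card (nbhd B y) \<le> 3" if "y \<in> N - {x, w}" for y
        using that card_mono[of "set [v, x, w]" "nbhd B y"] card_length[of "[v, x, w]"] by fastforce
      moreover have "k + 1 \<le> card (N - {x, w})"
        using \<open>k + 3 \<le> card N\<close> card_Diff_list[of N "[x, w]"] by simp
      ultimately show thesis
        using that[of "N - {x, w}"] by blast
    next
      case False
      then have "card (nbhd B x) \<le> 3" if "x \<in> N" for x
        using that card_mono[of "{v}" "nbhd B x"] by fastforce
      then show thesis
        using that[of N] \<open>k + 3 \<le> card N\<close> by simp
    qed
    then show ?thesis
      using NV k by (intro copy_of_dense[OF G V k, of S] T) (auto simp: B_def)
  next
    case False
    \<comment> \<open>No two complement edges between \<open>N\<close> and \<open>R\<close> are disjoint.\<close>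
    obtain x w where xw: "\<And>y. y \<in> N - {x} \<Longrightarrow> nbhd B y \<inter> R \<subseteq> {w}"
    proof (cases "\<exists>x\<in>N. \<exists>w\<in>nbhd B x. w \<in> R")
      case True
      then obtain x w where x: "x \<in> N" "w \<in> nbhd B x" "w \<in> R"
        by blast
      have "nbhd B y \<inter> R \<subseteq> {w}" if y: "y \<in> N - {x}" for y
      proof
        fix z assume z: "z \<in> nbhd B y \<inter> R"
        then have "N - {w, z} = N"
          using x disj by auto
        then show "z \<in> {w}"
          using no'[of x y w z] x y z NV RV disj v irrefl by (auto simp: N_def B_def)
      qed
      then show thesis
        using that by blast
    next
      case False
      then show thesis
        using that by blast
    qed
    have "card R - 1 \<le> card (R - {w})"
      using card_Diff_list[of R "[w]"] by simp
    \<comment> \<open>In \<open>G\<close> all edges between \<open>N - {x}\<close> and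
      \<open>R - {w}\<close> are present, so any \<open>r\<close> of \<open>R - {w}\<close> can be
      the centre, with \<open>N - {x}\<close> as leaves and at least \<open>k - 4\<close> further
      vertices of \<open>R\<close> adjacent to each leaf.\<close>
    then obtain r where r: "r \<in> R" "r \<noteq> w"
      using cards False k ex_notin_list[of "[w]" R] by auto
    have adj: "R - {w} \<subseteq> nbhd G u" if u: "u \<in> N - {x}" for u
    proof -
      have "u \<in> verts G"
        using u NV by auto
      from nB[OF this] show ?thesis
        using xw[OF u] u RV disj by auto
    qed
    have L: "k \<le> card (N - {x})"
      using card_Diff_list[of N "[x]"] v by (simp add: N_def B_def)
    show ?thesis
    proof (rule copy_of_bipartite[OF G _ L _ _ T, of r])
      show "N - {x} \<subseteq> nbhd G r"
        using adj r nbhd_sym[of _ G r] by blast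
      fix u assume u: "u \<in> N - {x}"
      have "R - {w, r} \<subseteq> nbhd G u - (N - {x}) - {r}"
        using adj[OF u] disj by auto
      then have "card (R - {w, r}) \<le> card (nbhd G u - (N - {x}) - {r})"
        using fin by (intro card_mono) auto
      then show "3 \<le> card (nbhd G u - (N - {x}) - {r})"
        using card_Diff_list[of R "[w, r]"] cards False k by simp
    qed (use k in auto)
  qed
qed

subsection \<open>Minimum degree at least half the number of vertices\<close>

text \<open>Three spare neighbours of \<open>v\<close> allow the pendant vertices to lie anywhere.
  Every greedy choice avoids at most five vertices, which \<open>6 \<le> k\<close> permits.\<close>

lemma copy_of_high_degree:
  assumes G: "fin_graph G" and v: "k + 3 \<le> card (nbhd G v)" and k: "6 \<le> k"
    and deg: "\<And>u. u \<in> verts G \<Longrightarrow> k \<le> card (nbhd G u)"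
    and T: "T \<in> small_star_trees k"
  shows "contains_copy G T"
proof -
  define N where "N = nbhd G v"
  have fit: "k \<le> card (nbhd G v - {w1, w2, w3})" for w1 w2 w3
    using card_Diff_list[of "nbhd G v" "[w1, w2, w3]"] v by simp
  have irrefl: "u \<notin> nbhd G u" for u
    using nbhd_subset[OF G] by blast
  have pick: "\<exists>w. w \<in> nbhd G u \<and> w \<notin> set ws" if "u \<in> N" "length ws \<le> 5" for u ws
  proof -
    have "k \<le> card (nbhd G u)"
      using that(1) nbhd_verts[OF G] deg by (auto simp: N_def)
    then have "length ws < card (nbhd G u)"
      using that(2) k by linarith
    then show ?thesis
      using ex_notin_list by blast
  qed
  have pickN: "\<exists>w. w \<in> N \<and> w \<notin> set ws" if "length ws \<le> 4" for ws
  proof -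
    have "length ws < card N"
      using that v k unfolding N_def by linarith
    then show ?thesis
      using ex_notin_list by blast
  qed
  obtain x where x: "x \<in> N"
    using pickN[of "[]"] by auto
  obtain w1 where w1: "w1 \<in> nbhd G x" "w1 \<noteq> v"
    using pick[of x "[v]"] x by auto
  have T3: "contains_copy G (T3 (k + 4))"
  proof -
    obtain w2 where w2: "w2 \<in> nbhd G x" "w2 \<notin> {v, w1}"
      using pick[of x "[v, w1]"] x by auto
    obtain w3 where w3: "w3 \<in> nbhd G x" "w3 \<notin> {v, w1, w2}"
      using pick[of x "[v, w1, w2]"] x by auto
    show ?thesis
      by (rule copy_T3[OF G, of x v w1 w2 w3]) (use x w1 w2 w3 fit k in \<open>auto simp: N_def\<close>)
  qed
  \<comment> \<open>Leaves are chosen after the pendant vertices fixed so far and avoid them, so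
    that no pendant vertex is later needed as a branching leaf.\<close>
  obtain y where y: "y \<in> N" "y \<notin> {x, w1}"
    using pickN[of "[x, w1]"] by auto
  have T_dprime: "contains_copy G (T_dprime (k + 4))"
  proof -
    obtain w2 where w2: "w2 \<in> nbhd G x" "w2 \<notin> {v, y, w1}"
      using pick[of x "[v, y, w1]"] x by auto
    obtain w3 where w3: "w3 \<in> nbhd G y" "w3 \<notin> {v, x, w1, w2}"
      using pick[of y "[v, x, w1, w2]"] y by auto
    show ?thesis
      by (rule copy_T_dprime[OF G, of x y v w1 w2 w3])
        (use x y w1 w2 w3 fit k irrefl in \<open>auto simp: N_def\<close>)
  qed
  have T_tprime: "contains_copy G (T_tprime (k + 4))"
  proof -
    obtain w2 where w2: "w2 \<in> nbhd G y" "w2 \<notin> {v, x, w1}"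
      using pick[of y "[v, x, w1]"] y by auto
    obtain z where z: "z \<in> N" "z \<notin> {x, w1, y, w2}"
      using pickN[of "[x, w1, y, w2]"] by auto
    obtain w3 where w3: "w3 \<in> nbhd G z" "w3 \<notin> {v, x, y, w1, w2}"
      using pick[of z "[v, x, y, w1, w2]"] z by auto
    show ?thesis
      by (rule copy_T_tprime[OF G, of x y z v w1 w2 w3])
        (use x y z w1 w2 w3 fit k irrefl in \<open>auto simp: N_def\<close>)
  qed
  show ?thesis
    using T T3 T_dprime T_tprime by blast
qed

text \<open>Only one neighbour of \<open>v\<close> is sure to be spare, so two pendant vertices are
  taken from \<open>R\<close>. Since \<open>card R \<le> k - 1\<close>, a vertex of \<open>R\<close>
  has at most \<open>k - 2\<close> neighbours in \<open>R\<close> and hence two in \<open>N\<close>;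
  this gives disjoint edges from \<open>r1\<close>, \<open>r2\<close> into \<open>N\<close>. The
  third pendant vertex costs at most one leaf.\<close>

lemma copy_of_degree_above:
  assumes G: "fin_graph G" and V: "card (verts G) = 2 * k + 1" and k: "6 \<le> k"
    and v: "v \<in> verts G" "k + 1 \<le> card (nbhd G v)" "card (nbhd G v) \<le> k + 2"
    and deg: "\<And>u. u \<in> verts G \<Longrightarrow> k \<le> card (nbhd G u)"
    and T: "T \<in> {T_dprime (k + 4), T_tprime (k + 4)}"
  shows "contains_copy G T"
proof -
  define N where "N = nbhd G v"
  define R where "R = verts G - {v} - N"
  have fin: "finite N" "finite R"
    using finite_nbhd[OF G] G by (auto simp: N_def R_def fin_graph_def)
  have NV: "N \<subseteq> verts G - {v}"
    using nbhd_subset[OF G] by (simp add: N_def)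
  have cards: "card R + card N = 2 * k"
    using card_nbhd_eq[OF G v(1) V] by (simp add: R_def N_def nbhd_complement[OF G v(1)])
  have irrefl: "u \<notin> nbhd G u" for u
    using nbhd_subset[OF G] by blast
  have nN: "2 \<le> card (nbhd G r \<inter> N)" if r: "r \<in> R" for r
  proof -
    have "v \<notin> nbhd G r"
      using r nbhd_sym[of v G r] by (auto simp: R_def N_def)
    then have "nbhd G r \<subseteq> (nbhd G r \<inter> N) \<union> (R - {r})"
      using nbhd_subset[OF G, of r] by (auto simp: R_def)
    then have "card (nbhd G r) \<le> card ((nbhd G r \<inter> N) \<union> (R - {r}))"
      using fin by (intro card_mono) auto
    also have "\<dots> \<le> card (nbhd G r \<inter> N) + (card R - 1)"
      using card_Un_le[of "nbhd G r \<inter> N" "R - {r}"] r fin by simp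
    finally show ?thesis
      using cards v deg[of r] r k by (auto simp: R_def N_def)
  qed
  have "2 \<le> card R"
    using cards v k by (simp add: N_def)
  then obtain r1 where r1: "r1 \<in> R"
    using ex_notin_list[of "[]" R] by auto
  obtain r2 where r2: "r2 \<in> R" "r2 \<noteq> r1"
    using \<open>2 \<le> card R\<close> ex_notin_list[of "[r1]" R] by auto
  obtain x where x: "x \<in> nbhd G r1 \<inter> N"
    using nN[OF r1] ex_notin_list[of "[]" "nbhd G r1 \<inter> N"] by auto
  obtain y where y: "y \<in> nbhd G r2 \<inter> N" "y \<noteq> x"
    using nN[OF r2(1)] ex_notin_list[of "[x]" "nbhd G r2 \<inter> N"] by auto
  have r: "r1 \<in> nbhd G x" "r2 \<in> nbhd G y" "r1 \<notin> N" "r2 \<notin> N" "r1 \<noteq> v" "r2 \<noteq> v"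
    using x y r1 r2 nbhd_sym[of _ G] by (auto simp: R_def)
  have fit: "k \<le> card (nbhd G v - {r1, w, r2})" "k \<le> card (nbhd G v - {r1, r2, w})" for w
  proof -
    have "nbhd G v - {r1, w, r2} = nbhd G v - set [w]" "nbhd G v - {r1, r2, w} = nbhd G v - set [w]"
      using r by (auto simp: N_def)
    then show "k \<le> card (nbhd G v - {r1, w, r2})" "k \<le> card (nbhd G v - {r1, r2, w})"
      using card_Diff_list[of "nbhd G v" "[w]"] v by auto
  qed
  have T_dprime: "contains_copy G (T_dprime (k + 4))"
  proof -
    have "k \<le> card (nbhd G x)"
      using x deg NV by auto
    then obtain w where w: "w \<in> nbhd G x" "w \<notin> set [v, y, r1, r2]"
      using ex_notin_list[of "[v, y, r1, r2]" "nbhd G x"] k by auto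
    show ?thesis
      by (rule copy_T_dprime[OF G, of x y v r1 w r2])
        (use x y r w r2 fit k irrefl in \<open>auto simp: N_def\<close>)
  qed
  have T_tprime: "contains_copy G (T_tprime (k + 4))"
  proof -
    obtain z where z: "z \<in> N" "z \<notin> set [x, y]"
      using v k ex_notin_list[of "[x, y]" N] by (auto simp: N_def)
    have "k \<le> card (nbhd G z)"
      using z deg NV by auto
    then obtain w where w: "w \<in> nbhd G z" "w \<notin> set [v, x, y, r1, r2]"
      using ex_notin_list[of "[v, x, y, r1, r2]" "nbhd G z"] k by auto
    show ?thesis
      by (rule copy_T_tprime[OF G, of x y z v r1 r2 w])
        (use x y z r w r2 fit k irrefl in \<open>auto simp: N_def\<close>)
  qed
  show ?thesis
    using T T_dprime T_tprime by blast
qed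

lemma ex_edge_leaving_nbhd:
  assumes G: "fin_graph G" and V: "card (verts G) = 2 * k + 1" and k: "13 \<le> k"
    and v: "v \<in> verts G"
    and deg: "\<And>u. u \<in> verts G \<Longrightarrow> k \<le> card (nbhd G u)" "card (nbhd G v) \<le> k + 2"
  shows "\<exists>u\<in>verts G. \<exists>x\<in>nbhd G u. 3 \<le> card (nbhd G x - nbhd G u - {u})"
proof (rule ccontr)
  assume "\<not> ?thesis"
  then have few: "card (nbhd G x - nbhd G u - {u}) \<le> 2" if "u \<in> verts G" "x \<in> nbhd G u" for u x
    using that by force
  define N where "N = nbhd G v"
  define R where "R = verts G - {v} - N"
  have fin: "finite N" "finite R"
    using finite_nbhd[OF G] G by (auto simp: N_def R_def fin_graph_def)
  have cards: "card R + card N = 2 * k"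
    using card_nbhd_eq[OF G v(1) V] by (simp add: R_def N_def nbhd_complement[OF G v(1)])
  have many: "k - 4 \<le> card (nbhd G r \<inter> N)" if r: "r \<in> R" for r
  proof -
    have vr: "v \<notin> nbhd G r" "r \<notin> nbhd G v" "r \<noteq> v" "r \<in> verts G"
      using r nbhd_sym[of v G r] by (auto simp: R_def N_def)
    have "\<not> nbhd G r \<subseteq> R - {r}"
    proof
      assume "nbhd G r \<subseteq> R - {r}"
      then have "card (nbhd G r) \<le> card R - 1"
        using card_mono[of "R - {r}" "nbhd G r"] fin r by simp
      moreover have "0 < card R"
        using r fin by (auto simp: card_gt_0_iff)
      ultimately show False
        using cards deg(1)[OF vr(4)] deg(1)[OF v] by (simp add: N_def)
    qed
    then obtain x where x: "x \<in> nbhd G r" "x \<in> nbhd G v"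
      using nbhd_subset[OF G, of r] vr by (auto simp: R_def N_def)
    \<comment> \<open>As \<open>v\<close> and \<open>r\<close> are distinct and not adjacent,
      \<open>v\<close> is caught by the second set and \<open>r\<close> by the first.\<close>
    have "nbhd G x \<subseteq> (nbhd G x - nbhd G v - {v}) \<union> (nbhd G x - nbhd G r - {r}) \<union> (nbhd G r \<inter> N)"
      using vr by (auto simp: N_def)
    then have "card (nbhd G x) \<le> card ((nbhd G x - nbhd G v - {v}) \<union> (nbhd G x - nbhd G r - {r})
        \<union> (nbhd G r \<inter> N))"
      using finite_nbhd[OF G] by (intro card_mono) auto
    also have "\<dots> \<le> card (nbhd G x - nbhd G v - {v}) + card (nbhd G x - nbhd G r - {r})
        + card (nbhd G r \<inter> N)"
      by (meson add_le_mono1 card_Un_le order_trans)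
    also have "\<dots> \<le> 2 + 2 + card (nbhd G r \<inter> N)"
      using few[OF v x(2)] few[OF vr(4) x(1)] by simp
    finally show ?thesis
      using deg(1)[of x] nbhd_verts[OF G x(2)] by simp
  qed
  \<comment> \<open>The 9 is \<open>13 - 4\<close>. With \<open>card R \<ge> k - 2\<close> and
    \<open>card N \<le> k + 2\<close>, nine edges per vertex of \<open>R\<close> exceed two per
    vertex of \<open>N\<close>.\<close>
  have "card R * 9 \<le> (\<Sum>r\<in>R. card (nbhd G r \<inter> N))"
    using many k sum_bounded_below[of R 9 "\<lambda>r. card (nbhd G r \<inter> N)"] by fastforce
  also have "\<dots> = (\<Sum>x\<in>N. card (nbhd G x \<inter> R))"
    using fin by (rule sum_card_nbhd_swap[rotated])
  also have "\<dots> \<le> card N * 2"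
  proof -
    have "card (nbhd G x \<inter> R) \<le> 2" if "x \<in> N" for x
    proof -
      have "card (nbhd G x \<inter> R) \<le> card (nbhd G x - nbhd G v - {v})"
        using finite_nbhd[OF G] by (intro card_mono) (auto simp: R_def N_def)
      then show ?thesis
        using few[OF v, of x] that by (simp add: N_def)
    qed
    then show ?thesis
      using sum_bounded_above[of N "\<lambda>x. card (nbhd G x \<inter> R)" 2] by simp
  qed
  finally show False
    using cards deg(2) k by (simp add: N_def)
qed

text \<open>The neighbourhood of \<open>v\<close> has no vertex to spare, so all pendant vertices
  must come from \<open>R\<close>. The vertex \<open>x\<close> has three neighbours there, and some
  \<open>r0\<close> in \<open>R\<close> not adjacent to \<open>x\<close> is joined to another leaf
  \<open>y\<close>; this already gives \<open>T_dprime\<close>.\<close>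

lemma copy_of_regular:
  assumes G: "fin_graph G" and V: "card (verts G) = 2 * k + 1" and k: "13 \<le> k"
    and deg: "\<And>u. u \<in> verts G \<Longrightarrow> card (nbhd G u) = k"
    and T: "T \<in> {T_dprime (k + 4), T_tprime (k + 4)}"
  shows "contains_copy G T"
proof -
  have "verts G \<noteq> {}"
    using V by auto
  then obtain v x where v: "v \<in> verts G" and x: "x \<in> nbhd G v"
    and out: "3 \<le> card (nbhd G x - nbhd G v - {v})"
    using ex_edge_leaving_nbhd[OF G V k] deg by fastforce
  define N where "N = nbhd G v"
  define R where "R = verts G - {v} - N"
  have fin: "finite N" "finite R"
    using finite_nbhd[OF G] G by (auto simp: N_def R_def fin_graph_def)
  have NV: "N \<subseteq> verts G - {v}"
    using nbhd_subset[OF G] by (simp add: N_def)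
  have cN: "card N = k" and cR: "card R = k"
    using card_nbhd_eq[OF G v(1) V] deg[OF v]
    by (simp_all add: R_def N_def nbhd_complement[OF G v(1)])
  have xV: "x \<in> verts G"
    using x NV by (auto simp: N_def)
  have out_R: "nbhd G x - nbhd G v - {v} = nbhd G x \<inter> R"
    using nbhd_subset[OF G, of x] by (auto simp: R_def N_def)
  have v_notin: "v \<notin> nbhd G r" if "r \<in> R" for r
    using that nbhd_sym[of v G r] by (auto simp: R_def N_def)
  \<comment> \<open>Together with \<open>v\<close> this would give \<open>x\<close> degree
    \<open>k + 1\<close>.\<close>
  have "\<not> R \<subseteq> nbhd G x"
  proof
    assume "R \<subseteq> nbhd G x"
    then have "insert v R \<subseteq> nbhd G x"
      using x nbhd_sym[of v G x] by simp
    then have "card (insert v R) \<le> k"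
      using card_mono[OF finite_nbhd[OF G]] deg[OF xV] by metis
    then show False
      using fin cR by (simp add: R_def)
  qed
  then obtain r0 where r0: "r0 \<in> R" "r0 \<notin> nbhd G x"
    by blast
  have "\<not> nbhd G r0 \<subseteq> R - {r0}"
  proof
    assume "nbhd G r0 \<subseteq> R - {r0}"
    then have "k \<le> card R - 1"
      using card_mono[of "R - {r0}" "nbhd G r0"] fin r0 deg[of r0] by (simp add: R_def)
    then show False
      using cR k by simp
  qed
  then obtain y where y: "y \<in> nbhd G r0" "y \<in> N"
    using nbhd_subset[OF G, of r0] v_notin[OF r0(1)] by (auto simp: R_def)
  have y': "r0 \<in> nbhd G y" "y \<noteq> x"
    using y r0 nbhd_sym[of _ G] by blast+
  have fit: "k \<le> card (nbhd G v - {w1, w2, w3})" if "{w1, w2, w3} \<subseteq> R" for w1 w2 w3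
  proof -
    have "nbhd G v - {w1, w2, w3} = N"
      using that by (auto simp: R_def N_def)
    then show ?thesis
      using cN by simp
  qed
  have T_dprime: "contains_copy G (T_dprime (k + 4))"
  proof -
    obtain w1 where w1: "w1 \<in> nbhd G x \<inter> R"
      using out ex_notin_list[of "[]" "nbhd G x \<inter> R"] by (auto simp: out_R)
    obtain w2 where w2: "w2 \<in> nbhd G x \<inter> R" "w2 \<noteq> w1"
      using out ex_notin_list[of "[w1]" "nbhd G x \<inter> R"] by (auto simp: out_R)
    show ?thesis
      by (rule copy_T_dprime[OF G, of x y v w1 w2 r0])
        (use x y y' w1 w2 r0 fit[of w1 w2 r0] k NV in \<open>auto simp: N_def R_def\<close>)
  qed
  have T_tprime: "contains_copy G (T_tprime (k + 4))"
  proof (rule ccontr)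
    assume no: "\<not> ?thesis"
    \<comment> \<open>A neighbour \<open>r\<close> of \<open>z\<close> in \<open>R\<close> other
      than \<open>r0\<close> would complete \<open>T_tprime\<close>: \<open>x\<close> has a
      neighbour in \<open>R\<close> besides \<open>r\<close>, and it differs from \<open>r0\<close>
      because \<open>r0\<close> is not adjacent to \<open>x\<close>.\<close>
    have sub: "r = r0" if z: "z \<in> N - {x, y}" "r \<in> nbhd G z" "r \<in> R" for z r
    proof (rule ccontr)
      assume r: "r \<noteq> r0"
      obtain w where w: "w \<in> nbhd G x \<inter> R" "w \<noteq> r"
        using out ex_notin_list[of "[r]" "nbhd G x \<inter> R"] by (auto simp: out_R)
      have "contains_copy G (T_tprime (k + 4))"
        by (rule copy_T_tprime[OF G, of x y z v w r0 r])
          (use x y y' w z r r0 fit[of w r0 r] k NV in \<open>auto simp: N_def R_def\<close>)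
      then show False
        using no by simp
    qed
    define X where "X = {x, y, r0}"
    define U where "U = verts G - {v, x, y, r0}"
    have neq: "v \<noteq> x" "v \<noteq> y" "v \<noteq> r0" "x \<noteq> y" "x \<noteq> r0" "y \<noteq> r0"
      using x y y' r0 NV by (auto simp: R_def N_def)
    then have X: "card X = 3" "finite X"
      by (simp_all add: X_def)
    have finU: "finite U"
      using G by (simp add: U_def fin_graph_def)
    have "card (verts G - {v, x, y, r0}) = card (verts G) - card {v, x, y, r0}"
      using v xV y NV r0 by (intro card_Diff_subset) (auto simp: R_def)
    moreover have "card {v, x, y, r0} = 4"
      using neq by simp
    ultimately have cU: "card U = 2 * k - 3"
      using V by (simp add: U_def)
    \<comment> \<open>\<open>u\<close> has only \<open>k + 1\<close> possible neighbours, so it misses at most one of them; then there are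
      more edges between \<open>X\<close> and \<open>U\<close> than the three degrees \<open>k\<close> allow.\<close>
    have two: "2 \<le> card (nbhd G u \<inter> X)" if u: "u \<in> U" for u
    proof -
      have "\<exists>Z. nbhd G u - X \<subseteq> Z \<and> finite Z \<and> card Z \<le> k - 2"
      proof (cases "u \<in> N")
        case True
        have "card (N - {u, x, y}) = k - 3"
          using True x y y' u cN by (subst card_Diff_subset) (auto simp: N_def U_def)
        then have "card (insert v (N - {u, x, y})) \<le> k - 2"
          using card_insert_le_m1[of "k - 2" "N - {u, x, y}" v] k by simp
        moreover have "nbhd G u - X \<subseteq> insert v (N - {u, x, y})"
          using sub[of u] True u nbhd_subset[OF G, of u] by (auto simp: U_def X_def R_def)
        ultimately show ?thesis
          using fin by blast
      next
        case False
        then have uR: "u \<in> R" "u \<noteq> r0"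
          using u by (auto simp: U_def R_def)
        have "nbhd G u - X \<subseteq> R - {u, r0}"
        proof
          fix z assume z: "z \<in> nbhd G u - X"
          then have "z \<notin> N"
            using sub[of z u] uR nbhd_sym[of z G u] by (auto simp: X_def)
          then show "z \<in> R - {u, r0}"
            using z nbhd_subset[OF G, of u] v_notin[OF uR(1)] by (auto simp: R_def X_def)
        qed
        moreover have "card (R - {u, r0}) = k - 2"
          using uR r0 cR by (subst card_Diff_subset) auto
        ultimately show ?thesis
          using fin by (intro exI[of _ "R - {u, r0}"]) auto
      qed
      then have "card (nbhd G u - X) \<le> k - 2"
        by (meson card_mono le_trans)
      moreover have "card (nbhd G u) = card (nbhd G u \<inter> X) + card (nbhd G u - X)"
        using finite_nbhd[OF G] by (metis card_Int_Diff)
      ultimately show ?thesis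
        using deg[of u] u k by (simp add: U_def)
    qed
    have "card U * 2 \<le> (\<Sum>u\<in>U. card (nbhd G u \<inter> X))"
      using two sum_bounded_below[of U 2 "\<lambda>u. card (nbhd G u \<inter> X)"] by simp
    also have "\<dots> = (\<Sum>s\<in>X. card (nbhd G s \<inter> U))"
      using finU X by (intro sum_card_nbhd_swap)
    also have "\<dots> = card (nbhd G x \<inter> U) + card (nbhd G y \<inter> U) + card (nbhd G r0 \<inter> U)"
      using neq by (simp add: X_def)
    \<comment> \<open>The neighbours lost outside \<open>U\<close> are \<open>v\<close> for
      \<open>x\<close>, \<open>v\<close> and \<open>r0\<close> for \<open>y\<close>, and
      \<open>y\<close> for \<open>r0\<close>. The total \<open>3 * k - 4\<close> is below
      \<open>2 * card U = 4 * k - 6\<close>.\<close>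
    also have "\<dots> \<le> (k - 1) + (k - 2) + (k - 1)"
    proof -
      have bound: "card (nbhd G s \<inter> U) \<le> k - card F"
        if "s \<in> verts G" "F \<subseteq> nbhd G s" "F \<inter> U = {}" for s F
      proof -
        have "card (nbhd G s \<inter> U) \<le> card (nbhd G s - F)"
          using that finite_nbhd[OF G] by (intro card_mono) auto
        also have "\<dots> = k - card F"
          using that deg[of s] finite_nbhd[OF G]
          by (subst card_Diff_subset) (auto intro: finite_subset)
        finally show ?thesis .
      qed
      have "v \<in> nbhd G x" "v \<in> nbhd G y"
        using x y nbhd_sym[of v G] by (auto simp: N_def)
      then show ?thesis
        using bound[of x "{v}"] bound[of y "{v, r0}"] bound[of r0 "{y}"] xV y y' r0 NV
        by (fastforce simp: U_def R_def)
    qed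
    finally show False
      using cU k by simp
  qed
  show ?thesis
    using T T_dprime T_tprime by blast
qed

lemma copy_of_small_star_tree:
  assumes G: "fin_graph G" and V: "card (verts G) = 2 * k + 1" and k: "13 \<le> k"
    and no: "\<not> contains_copy (complement_graph G) T'" and T': "T' \<in> {T1 (k + 4), T2 (k + 4)}"
    and T: "T \<in> small_star_trees k"
  shows "contains_copy G T"
proof (cases "\<exists>v\<in>verts G. k + 1 \<le> card (nbhd (complement_graph G) v)")
  case True
  then obtain v where v: "v \<in> verts G" "k + 1 \<le> card (nbhd (complement_graph G) v)" ..
  have k7: "7 \<le> k"
    using k by simp
  show ?thesis
    using copy_if_no_T1_in_complement[OF G V k7 v _ T] copy_if_no_T2_in_complement[OF G V k7 v _ T] no T'
    by blast
next
  case False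
  have deg: "k \<le> card (nbhd G u)" if "u \<in> verts G" for u
    using card_nbhd_eq[OF G that V] False that by force
  show ?thesis
  proof (cases "\<exists>v\<in>verts G. k + 3 \<le> card (nbhd G v)")
    case True
    then obtain v where "k + 3 \<le> card (nbhd G v)"
      by blast
    then show ?thesis
      using k by (intro copy_of_high_degree[OF G _ _ deg T]) auto
  next
    case False
    then have le: "card (nbhd G u) \<le> k + 2" if "u \<in> verts G" for u
      using that by force
    show ?thesis
    proof (cases "T = T3 (k + 4)")
      case True
      have "verts G \<noteq> {}"
        using V by auto
      then obtain v x where v: "v \<in> verts G" and x: "x \<in> nbhd G v"
        and out: "3 \<le> card (nbhd G x - nbhd G v - {v})"
        using ex_edge_leaving_nbhd[OF G V k _ deg] le by fastforce
      obtain w1 w2 w3 where w: "{w1, w2, w3} \<subseteq> nbhd G x - nbhd G v - {v}" "distinct [w1, w2, w3]"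
        using obtain_three[OF out] by blast
      \<comment> \<open>All three pendant vertices lie outside the neighbourhood of
        \<open>v\<close>, so degree \<open>k\<close> is enough.\<close>
      then have "nbhd G v - {w1, w2, w3} = nbhd G v"
        by auto
      then show ?thesis
        unfolding True using w x deg[OF v] k by (intro copy_T3[OF G, of x v w1 w2 w3]) auto
    next
      case False
      then have T: "T \<in> {T_dprime (k + 4), T_tprime (k + 4)}"
        using T by simp
      show ?thesis
      proof (cases "\<exists>v\<in>verts G. k + 1 \<le> card (nbhd G v)")
        case True
        then obtain v where v: "v \<in> verts G" "k + 1 \<le> card (nbhd G v)" ..
        have k6: "6 \<le> k"
          using k by simp
        show ?thesis
          by (rule copy_of_degree_above[OF G V k6 v le[OF v(1)] deg T])
      next
        case False
        then have "card (nbhd G u) = k" if "u \<in> verts G" for u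
          using deg[OF that] that by force
        then show ?thesis
          using copy_of_regular[OF G V k _ T] by blast
      qed
    qed
  qed
qed

subsection \<open>The Ramsey numbers\<close>

text \<open>The number \<open>N\<close> of vertices is kept free because minimality calls for a
  counterexample at every \<open>N \<le> 2 * k\<close>, not only at \<open>2 * k\<close>.\<close>

definition two_cliques :: "nat \<Rightarrow> nat \<Rightarrow> nat graph" where
  "two_cliques k N = ({0..<N}, {e \<in> [{0..<N}]\<^bsup>2\<^esup>. e \<subseteq> {..<k} \<or> e \<subseteq> {k..}})"

lemma fin_graph_two_cliques: "fin_graph (two_cliques k N)"
  by (auto simp: fin_graph_def two_cliques_def)

lemma verts_two_cliques: "verts (two_cliques k N) = {0..<N}"
  by (simp add: two_cliques_def)

lemma nbhd_two_cliques:
  "nbhd (two_cliques k N) v = {w. v \<noteq> w \<and> v < N \<and> w < N \<and> (v < k \<longleftrightarrow> w < k)}"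
  unfolding nbhd_def two_cliques_def by (rule Collect_cong) (simp, linarith)

lemma card_nbhd_two_cliques:
  assumes "N \<le> 2 * k" "0 < k"
  shows "card (nbhd (two_cliques k N) v) < k" (is ?less)
    and "card (nbhd (complement_graph (two_cliques k N)) v) \<le> k" (is ?le)
proof -
  have "?less \<and> ?le" if v: "v < N"
  proof -
    have compl: "nbhd (complement_graph (two_cliques k N)) v = {w. w < N \<and> (v < k \<longleftrightarrow> \<not> w < k)}"
    proof -
      have "v \<in> verts (two_cliques k N)"
        using v by (simp add: verts_two_cliques)
      note nbhd_complement[OF fin_graph_two_cliques this, unfolded verts_two_cliques nbhd_two_cliques]
      also have "{0..<N} - {v} - {w. v \<noteq> w \<and> v < N \<and> w < N \<and> (v < k \<longleftrightarrow> w < k)} =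
          {w. w < N \<and> (v < k \<longleftrightarrow> \<not> w < k)}"
        using v by auto
      finally show ?thesis .
    qed
    show ?thesis
    proof (cases "v < k")
      case True
      then have "nbhd (two_cliques k N) v \<subseteq> {0..<k} - {v}"
        "{w. w < N \<and> (v < k \<longleftrightarrow> \<not> w < k)} \<subseteq> {k..<2 * k}"
        using assms by (auto simp: nbhd_two_cliques)
      then show ?thesis
        using card_mono[of "{0..<k} - {v}" "nbhd (two_cliques k N) v"]
          card_mono[of "{k..<2 * k}" "{w. w < N \<and> (v < k \<longleftrightarrow> \<not> w < k)}"] True assms(2)
        by (simp add: compl)
    next
      case False
      then have "nbhd (two_cliques k N) v \<subseteq> {k..<2 * k} - {v}"
        "{w. w < N \<and> (v < k \<longleftrightarrow> \<not> w < k)} \<subseteq> {0..<k}"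
        using assms by (auto simp: nbhd_two_cliques)
      then show ?thesis
        using card_mono[of "{k..<2 * k} - {v}" "nbhd (two_cliques k N) v"]
          card_mono[of "{0..<k}" "{w. w < N \<and> (v < k \<longleftrightarrow> \<not> w < k)}"] False assms v
        by (simp add: compl)
    qed
  qed
  \<comment> \<open>Needed because \<open>contains_copy_degree\<close> yields some \<open>v\<close>
    without saying that it is a vertex.\<close>
  moreover have "?less \<and> ?le" if v: "\<not> v < N"
  proof -
    have "v \<notin> verts (two_cliques k N)"
      using v by (simp add: verts_two_cliques)
    then have "nbhd (two_cliques k N) v = {}" "nbhd (complement_graph (two_cliques k N)) v = {}"
      using nbhd_verts[OF fin_graph_two_cliques]
        nbhd_verts[OF fin_graph_complement[OF fin_graph_two_cliques]]
      by (auto simp: complement_graph_def)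
    then show ?thesis
      using assms by simp
  qed
  ultimately show ?less ?le
    by blast+
qed

lemma ramsey_number_small_star_tree:
  assumes k: "13 \<le> k" and T': "T' \<in> {T1 (k + 4), T2 (k + 4)}" and T: "T \<in> small_star_trees k"
  shows "ramsey_number T T' = 2 * k + 1"
  unfolding ramsey_number_def
proof (rule Least_equality)
  have "contains_copy G T \<or> contains_copy (complement_graph G) T'"
    if "fin_graph G" "card (verts G) = 2 * k + 1" for G :: "nat graph"
    using copy_of_small_star_tree[OF that k _ T' T] by blast
  then show "0 < 2 * k + 1 \<and> (\<forall>G :: nat graph. fin_graph G \<and> card (verts G) = 2 * k + 1 \<longrightarrow>
    contains_copy G T \<or> contains_copy (complement_graph G) T')"
    by simp
next
  fix N :: nat
  assume N: "0 < N \<and> (\<forall>G :: nat graph. fin_graph G \<and> card (verts G) = N \<longrightarrow>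
    contains_copy G T \<or> contains_copy (complement_graph G) T')"
  show "2 * k + 1 \<le> N"
  proof (rule ccontr)
    assume "\<not> ?thesis"
    then have N2: "N \<le> 2 * k"
      by simp
    let ?G = "two_cliques k N"
    \<comment> \<open>The centre has at least \<open>k\<close> neighbours in \<open>T\<close> and
      \<open>k + 1\<close> in \<open>T'\<close>, one more than the two cliques and their complement
      allow.\<close>
    have star: "{1..k} \<subseteq> nbhd T 0 \<inter> verts T" "0 \<in> verts T"
      using T by (auto simp: nbhd_def T3_def T_dprime_def T_tprime_def)
    have star': "{1..k + 1} \<subseteq> nbhd T' 0 \<inter> verts T'" "0 \<in> verts T'"
      using T' by (auto simp: nbhd_def T1_def T2_def)
    have G: "fin_graph ?G"
      by (rule fin_graph_two_cliques)
    have "card (verts ?G) = N"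
      by (simp add: verts_two_cliques)
    with N G have "contains_copy ?G T \<or> contains_copy (complement_graph ?G) T'"
      by blast
    then show False
    proof
      assume "contains_copy ?G T"
      then obtain v where "card {1..k} \<le> card (nbhd ?G v)"
        using contains_copy_degree[OF _ G star(2,1)] by blast
      then show False
        using card_nbhd_two_cliques(1)[OF N2, of v] k by simp
    next
      assume "contains_copy (complement_graph ?G) T'"
      then obtain v where "card {1..k + 1} \<le> card (nbhd (complement_graph ?G) v)"
        using contains_copy_degree[OF _ fin_graph_complement[OF G] star'(2,1)] by blast
      then show False
        using card_nbhd_two_cliques(2)[OF N2, of v] k by simp
    qed
  qed
qed

theorem theorem3p4:
  fixes n :: nat and T :: "nat graph"
  assumes "n > 16" and "T \<in> {T1 n, T2 n}"
  shows "ramsey_number (T_dprime n) T = 2 * n - 7 \<and>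
         ramsey_number (T_tprime n) T = 2 * n - 7 \<and>
         ramsey_number (T3 n) T = 2 * n - 7"
proof -
  \<comment> \<open>With \<open>n = k + 4\<close> the value \<open>2 * n - 7\<close> becomes
    \<open>2 * k + 1\<close>, and \<open>n > 16\<close> becomes \<open>13 \<le> k\<close>.\<close>
  obtain k where k: "n = k + 4" "13 \<le> k"
    using assms(1) by (intro that[of "n - 4"]) auto
  then have "ramsey_number S T = 2 * n - 7" if "S \<in> small_star_trees k" for S
    using ramsey_number_small_star_tree[OF k(2) _ that, of T] assms(2) by auto
  then show ?thesis
    by (simp add: k(1))
qed

end
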